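(* Let $m \geq 0$ and $n \geq 1$ be integers, and let $K$ be a field whose characteristic $p$ is either $0$ or satisfies $n = p^s n'$ for some integer $s \geq 0$ and some positive integer $n'$ with $n' < p$. Then for any elements $a_0, \dots, a_m \in K$, there exist a finite algebraic extension $L / K$ and a polynomial $f(x) \in L[x]$ such that for every $0 \leq j \leq m$, the coefficient of $x^{jn}$ in $f(x)^n$ equals $a_j$.
   Context: Convention: for any polynomial $g$ and any integer $t > \deg(g)$, the degree-$t$ coefficient of $g$ is considered to be $0$. *)

theory Defs
  imports "HOL-Algebra.Algebraic_Closure_Type"
begin

text \<open>
  Every finite extension of a field \<open>K\<close> embeds over \<open>K\<close> into an algebraic closure of \<open>K\<close>.
  A finite extension of the type \<^typ>\<open>'a :: field\<close> is therefore represented as an intermediate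
  field of \<^typ>\<open>'a alg_closure\<close>, with the base field identified with the range of \<^const>\<open>to_ac\<close>.
  Extensions of finite degree are automatically algebraic.
\<close>

definition finite_extension :: "'a :: field alg_closure set \<Rightarrow> bool" where
  "finite_extension L \<longleftrightarrow>
     subfield L ring_of_type_algebra \<and>
     range to_ac \<subseteq> L \<and>
     ring.finite_dimension ring_of_type_algebra (range to_ac) L"

end

theory Submission
  imports Defs
begin

text \<open>
  If \<open>n\<close> is invertible, write \<open>\<Sum>\<^bsub>j\<le>m\<^esub> a\<^sub>j y\<^sup>j = y\<^sup>k c(y)\<close> with \<open>c(0) \<noteq> 0\<close>. The power series \<open>c\<close> has an
  \<open>n\<close>-th root \<open>u\<close>, which is truncated to a polynomial, and \<open>f = x\<^sup>k u(x\<^sup>n)\<close> satisfies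
  \<open>f\<^sup>n \<equiv> \<Sum>\<^bsub>j\<le>m\<^esub> a\<^sub>j x\<^bsup>jn\<^esup>\<close> up to terms of degree greater than \<open>mn\<close>. For \<open>n = p\<^sup>s n'\<close>
  in characteristic \<open>p\<close>, solve the problem for \<open>n'\<close> and the \<open>p\<^sup>s\<close>-th roots of the \<open>a\<^sub>j\<close>, and then apply the Frobenius map \<open>s\<close> times.
  The finitely many coefficients of \<open>f\<close> generate a finite extension of the base field.
\<close>

subsection \<open>Polynomials whose powers have prescribed coefficients\<close>

text \<open>First-order Taylor expansion for a Newton-type correction: when \<open>w\<close> is
  divisible by a high power of x, the term in \<open>w\<^sup>2\<close> is negligible.\<close>

lemma add_power_linearization:
  fixes u w :: "'b :: comm_ring_1"
  shows "\<exists>q. (u + w) ^ n = u ^ n + of_nat n * u ^ (n - 1) * w + w\<^sup>2 * q"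
proof (induction n)
  case (Suc n)
  then obtain q where q: "(u + w) ^ n = u ^ n + of_nat n * u ^ (n - 1) * w + w\<^sup>2 * q"
    by blast
  have *: "of_nat n * u ^ (n - 1) * u = of_nat n * u ^ n"
    by (cases n) (auto simp: mult_ac)
  have "(u + w) ^ Suc n = u * u ^ n + (of_nat n * u ^ (n - 1) * u) * w + u ^ n * w
          + w\<^sup>2 * (of_nat n * u ^ (n - 1) + q * (u + w))"
    by (simp add: q algebra_simps power2_eq_square)
  also have "\<dots> = u ^ Suc n + of_nat (Suc n) * u ^ (Suc n - 1) * w
          + w\<^sup>2 * (of_nat n * u ^ (n - 1) + q * (u + w))"
    unfolding * by (simp add: algebra_simps)
  finally show ?case
    by blast
qed (auto intro: exI[of _ 0])

text \<open>Coefficients are found one at a time: a root of \<open>c 0\<close> starts the process,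
  and each further one solves a linear equation with slope \<open>n * u(0) ^ (n - 1)\<close>, which
  is nonzero.\<close>

lemma truncated_nth_root_exists:
  fixes c :: "nat \<Rightarrow> 'b :: alg_closed_field"
  assumes n: "of_nat n \<noteq> (0 :: 'b)" and c0: "c 0 \<noteq> 0"
  shows "\<exists>u. \<forall>j\<le>N. Polynomial.coeff (u ^ n) j = c j"
proof (induction N)
  case 0
  from n have "n > 0"
    by (cases n) auto
  then obtain r where "r ^ n = c 0"
    using nth_root_exists by blast
  then have "Polynomial.coeff ([:r:] ^ n) 0 = c 0"
    by (simp add: poly_const_pow)
  then show ?case
    by blast
next
  case (Suc N)
  then obtain u where u: "\<And>j. j \<le> N \<Longrightarrow> Polynomial.coeff (u ^ n) j = c j"
    by blast
  from n have "n > 0"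
    by (cases n) auto
  have "Polynomial.coeff u 0 ^ n = c 0"
    using u[of 0] by (simp add: coeff_0_power)
  with c0 \<open>n > 0\<close> have "Polynomial.coeff u 0 \<noteq> 0"
    by (auto simp: power_0_left)
  define v where "v = of_nat n * u ^ (n - 1)"
  have v0: "Polynomial.coeff v 0 \<noteq> 0"
    using n \<open>Polynomial.coeff u 0 \<noteq> 0\<close> by (simp add: v_def coeff_0_power of_nat_poly mult.commute)
  \<comment> \<open>Chosen so that adding \<open>e * v(0)\<close> corrects the coefficient of degree
    \<open>Suc N\<close>.\<close>
  define e where "e = (c (Suc N) - Polynomial.coeff (u ^ n) (Suc N)) / Polynomial.coeff v 0"
  define w where "w = Polynomial.monom e (Suc N)"
  obtain q where "(u + w) ^ n = u ^ n + v * w + w\<^sup>2 * q"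
    using add_power_linearization[of u w n] by (auto simp: v_def)
  then have "(u + w) ^ n = u ^ n + Polynomial.monom e (Suc N) * (v + w * q)"
    by (simp add: w_def algebra_simps power2_eq_square)
  \<comment> \<open>Degrees up to \<open>N\<close> are untouched; in degree \<open>Suc N\<close>
    only the constant term of \<open>v + w * q\<close> counts, and it is \<open>v(0)\<close> because
    \<open>w\<close> has none.\<close>
  then have "Polynomial.coeff ((u + w) ^ n) j = c j" if "j \<le> Suc N" for j
    using that u v0 by (auto simp: coeff_monom_mult e_def w_def le_Suc_eq)
  then show ?case
    by blast
qed

lemma coeff_pcompose_monom_mult:
  fixes p :: "'b :: comm_ring_1 poly"
  assumes "n > 0"
  shows "Polynomial.coeff (pcompose p (Polynomial.monom 1 n)) (j * n) = Polynomial.coeff p j"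
proof (induction p arbitrary: j)
  case (pCons a p)
  then show ?case
    using assms by (cases j) (auto simp: pcompose_pCons coeff_monom_mult coeff_pCons split: nat.splits)
qed simp

lemma pcompose_power: "pcompose (p ^ n) q = pcompose p q ^ n"
  for p q :: "'b :: comm_ring_1 poly"
  by (induction n) (auto simp: pcompose_mult pcompose_1)

lemma power_with_coeffs_exists_of_nat_nonzero:
  fixes b :: "nat \<Rightarrow> 'b :: alg_closed_field"
  assumes n: "of_nat n \<noteq> (0 :: 'b)"
  shows "\<exists>f. \<forall>j\<le>m. Polynomial.coeff (f ^ n) (j * n) = b j"
proof -
  from n have "n > 0"
    by (cases n) auto
  show ?thesis
  proof (cases "\<forall>j\<le>m. b j = 0")
    case True
    with \<open>n > 0\<close> have "\<forall>j\<le>m. Polynomial.coeff (0 ^ n) (j * n) = b j"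
      by (auto simp: power_0_left)
    then show ?thesis ..
  next
    case False
    \<comment> \<open>Shifting by \<open>k\<close> gives the root lemma the nonzero constant term it
      requires.\<close>
    define k where "k = (LEAST j. b j \<noteq> 0)"
    have k: "b k \<noteq> 0"
      unfolding k_def using False LeastI_ex[of "\<lambda>j. b j \<noteq> 0"] by blast
    have less_k: "b j = 0" if "j < k" for j
      using not_less_Least[of j "\<lambda>j. b j \<noteq> 0"] that by (auto simp: k_def)
    obtain u where u: "\<And>j. j \<le> m \<Longrightarrow> Polynomial.coeff (u ^ n) j = b (j + k)"
      using truncated_nth_root_exists[OF n, of "\<lambda>j. b (j + k)" m] k by auto
    \<comment> \<open>The n-th power turns the factor \<open>x^k\<close> into
      \<open>x^(k*n)\<close>, which undoes the shift by \<open>k\<close> in the variable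
      \<open>x^n\<close>.\<close>
    define f where "f = Polynomial.monom 1 k * pcompose u (Polynomial.monom 1 n)"
    have "f ^ n = Polynomial.monom 1 (k * n) * pcompose (u ^ n) (Polynomial.monom 1 n)"
      by (simp add: f_def power_mult_distrib monom_power pcompose_power)
    then have "Polynomial.coeff (f ^ n) (j * n) = b j" if "j \<le> m" for j
      using that \<open>n > 0\<close> less_k u[of "j - k"]
      by (auto simp: coeff_monom_mult coeff_pcompose_monom_mult simp flip: diff_mult_distrib)
    then show ?thesis
      by blast
  qed
qed

text \<open>Frobenius is additive on polynomials, so it raises each coefficient and each monomial to
  the power p separately; the induction peels off constant terms.\<close>

lemma coeff_power_CHAR:
  fixes g :: "'b :: comm_semiring_1 poly"
  assumes "prime CHAR('b)"
  shows "Polynomial.coeff (g ^ CHAR('b)) (i * CHAR('b)) = Polynomial.coeff g i ^ CHAR('b)"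
proof (induction g arbitrary: i)
  case 0
  then show ?case
    using prime_gt_0_nat[OF assms] by (simp add: power_0_left)
next
  case (pCons a g)
  have "pCons a g = [:a:] + Polynomial.monom 1 1 * g"
    by (simp add: monom_altdef)
  then have "pCons a g ^ CHAR('b) = [:a:] ^ CHAR('b) + (Polynomial.monom 1 1 * g) ^ CHAR('b)"
    using freshmans_dream[where x = "[:a:]" and y = "Polynomial.monom 1 1 * g"] assms by simp
  also have "\<dots> = [:a ^ CHAR('b):] + Polynomial.monom 1 CHAR('b) * g ^ CHAR('b)"
    by (simp add: power_mult_distrib monom_power poly_const_pow)
  finally show ?case
    using pCons.IH prime_gt_0_nat[OF assms]
    by (cases i) (auto simp: coeff_monom_mult coeff_pCons split: nat.splits)
qed

lemma coeff_power_CHAR_power: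
  fixes g :: "'b :: comm_semiring_1 poly"
  assumes "prime CHAR('b)"
  shows "Polynomial.coeff (g ^ (CHAR('b) ^ s)) (i * CHAR('b) ^ s) = Polynomial.coeff g i ^ (CHAR('b) ^ s)"
proof (induction s)
  case (Suc s)
  then show ?case
    using coeff_power_CHAR[OF assms, of "g ^ (CHAR('b) ^ s)" "i * CHAR('b) ^ s"]
    by (simp add: mult_ac flip: power_mult)
qed simp

lemma power_with_coeffs_exists:
  fixes b :: "nat \<Rightarrow> 'b :: alg_closed_field"
  assumes "n \<ge> 1"
    and "CHAR('b) = 0 \<or> (\<exists>s n'. n' > 0 \<and> n' < CHAR('b) \<and> n = CHAR('b) ^ s * n')"
  shows "\<exists>f. \<forall>j\<le>m. Polynomial.coeff (f ^ n) (j * n) = b j"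
  using assms(2)
proof (elim disjE exE conjE)
  assume "CHAR('b) = 0"
  with assms(1) have "of_nat n \<noteq> (0 :: 'b)"
    by (simp add: of_nat_eq_0_iff_char_dvd)
  then show ?thesis
    by (rule power_with_coeffs_exists_of_nat_nonzero)
next
  fix s n'
  assume n': "n' > 0" "n' < CHAR('b)" and n: "n = CHAR('b) ^ s * n'"
  define q where "q = CHAR('b) ^ s"
  have prime: "prime CHAR('b)"
    using n' by (intro prime_CHAR_semidom) auto
  have "q > 0"
    using n' by (simp add: q_def)
  then have "\<forall>j. \<exists>r. r ^ q = b j"
    using nth_root_exists by blast
  then obtain r where r: "\<And>j. r j ^ q = b j"
    by metis
  \<comment> \<open>Since \<open>0 < n' < p\<close>, the characteristic p cannot divide
    \<open>n'\<close>.\<close>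
  have "of_nat n' \<noteq> (0 :: 'b)"
    using n' by (auto simp: of_nat_eq_0_iff_char_dvd dest: dvd_imp_le)
  then obtain f where f: "\<And>j. j \<le> m \<Longrightarrow> Polynomial.coeff (f ^ n') (j * n') = r j"
    using power_with_coeffs_exists_of_nat_nonzero by blast
  have "Polynomial.coeff (f ^ n) (j * n) = b j" if "j \<le> m" for j
  proof -
    have "Polynomial.coeff (f ^ n) (j * n) = Polynomial.coeff ((f ^ n') ^ q) (j * n' * q)"
      by (simp add: n q_def mult_ac flip: power_mult)
    also have "\<dots> = b j"
      using coeff_power_CHAR_power[OF prime, of "f ^ n'" s "j * n'"] f[OF that] r
      by (simp add: q_def)
    finally show ?thesis .
  qed
  then show ?thesis
    by blast
qed

subsection \<open>Finitely generated subextensions of the algebraic closure\<close>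

lemma subfield_range_to_ac:
  "subfield (range (to_ac :: 'a :: field \<Rightarrow> _)) ring_of_type_algebra"
proof -
  let ?R = "ring_of_type_algebra :: 'a alg_closure ring"
  interpret R: field ?R
    by (rule field_from_type_algebra)
  \<comment> \<open>The record's inverses are defined by description, so uniqueness identifies them
    with the type class operations.\<close>
  have inv: "a_inv ?R x = - x" for x
    by (rule sym, rule R.sum_zero_eq_neg) (auto simp: ring_of_type_algebra_def)
  have minv: "m_inv ?R x = inverse x" if "x \<noteq> 0" for x
    using that by (intro R.inv_unique'[symmetric]) (auto simp: ring_of_type_algebra_def)
  show ?thesis
  proof (rule R.subfieldI')
    show "subring (range to_ac) ?R"
    proof (rule R.subringI)
      fix x y :: "'a alg_closure"
      assume "x \<in> range to_ac" "y \<in> range to_ac"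
      then obtain x' y' where xy: "x = to_ac x'" "y = to_ac y'"
        by auto
      show "a_inv ?R x \<in> range to_ac"
        unfolding inv xy by (metis rangeI to_ac_minus)
      show "x \<otimes>\<^bsub>?R\<^esub> y \<in> range to_ac" "x \<oplus>\<^bsub>?R\<^esub> y \<in> range to_ac"
        unfolding xy by (simp_all add: ring_of_type_algebra_def flip: to_ac_mult to_ac_add)
    qed (auto simp: ring_of_type_algebra_def simp flip: to_ac_1)
  next
    fix x :: "'a alg_closure"
    assume "x \<in> range to_ac - {\<zero>\<^bsub>?R\<^esub>}"
    then obtain x' where "x = to_ac x'" "x \<noteq> 0"
      by (auto simp: ring_of_type_algebra_def)
    then show "m_inv ?R x \<in> range to_ac"
      by (simp add: minv flip: to_ac_inverse)
  qed
qed

text \<open>\<open>eval\<close> reads the leading coefficient first, \<open>Poly\<close> the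
  constant one; hence \<open>rev\<close>.\<close>

lemma eval_ring_of_type_algebra:
  "ring.eval (ring_of_type_algebra :: 'b :: field ring) xs x = poly (Poly (rev xs)) x"
proof -
  interpret R: field "ring_of_type_algebra :: 'b ring"
    by (rule field_from_type_algebra)
  have pow: "x [^]\<^bsub>ring_of_type_algebra\<^esub> k = x ^ k" for k :: nat
    by (induction k) (auto simp: ring_of_type_algebra_def)
  show ?thesis
    by (induction xs) (auto simp: pow Poly_append poly_monom, auto simp: ring_of_type_algebra_def)
qed

lemma algebraic_over_range_to_ac:
  fixes x :: "'a :: field alg_closure"
  shows "(ring.algebraic ring_of_type_algebra over range to_ac) x"
proof -
  let ?R = "ring_of_type_algebra :: 'a alg_closure ring"
  interpret R: field ?R
    by (rule field_from_type_algebra)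
  obtain p :: "'a poly" where p: "p \<noteq> 0" "poly (map_poly to_ac p) x = 0"
    by (rule alg_closure_algebraic)
  define P where "P = rev (Polynomial.coeffs (map_poly to_ac p))"
  have "map_poly to_ac p \<noteq> 0"
    using p by (auto simp: map_poly_eq_0_iff)
  show ?thesis
  proof (rule R.algebraicI)
    show "P \<noteq> []"
      using \<open>map_poly to_ac p \<noteq> 0\<close> by (simp add: P_def)
    show "R.eval P x = \<zero>\<^bsub>?R\<^esub>"
      using p by (simp add: eval_ring_of_type_algebra P_def) (simp add: ring_of_type_algebra_def)
    have "set P \<subseteq> range to_ac"
      by (auto simp: P_def coeffs_def coeff_map_poly)
    \<comment> \<open>A valid coefficient list must have a nonzero head, here the leading
      coefficient.\<close>
    moreover have "hd P \<noteq> 0"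
      using \<open>map_poly to_ac p \<noteq> 0\<close> by (simp add: P_def hd_rev last_coeffs_eq_coeff_degree)
    ultimately show "P \<in> carrier (univ_poly ?R (range to_ac))"
      by (auto simp: univ_poly_def polynomial_def ring_of_type_algebra_def)
  qed
qed

text \<open>Adjoining finitely many algebraic elements gives a field of finite degree.\<close>

lemma finite_extension_containing_finite_set:
  fixes S :: "'a :: field alg_closure set"
  assumes "finite S"
  obtains L where "finite_extension L" "S \<subseteq> L"
proof -
  let ?R = "ring_of_type_algebra :: 'a alg_closure ring"
  let ?K = "range to_ac :: 'a alg_closure set"
  interpret R: field ?R
    by (rule field_from_type_algebra)
  have carrier: "carrier ?R = UNIV"
    by (simp add: ring_of_type_algebra_def)
  obtain xs where xs: "set xs = S"
    using finite_list[OF assms] by blast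
  note K = subfield_range_to_ac[where 'a = 'a]
  let ?L = "R.finite_extension ?K xs"
  have "subfield ?L ?R" "R.finite_dimension ?K ?L"
    using R.finite_extension_is_subfield[OF K] R.finite_extension_finite_dimension(1)[OF K]
      algebraic_over_range_to_ac by (auto simp: carrier)
  moreover have "?K \<subseteq> ?L"
    by (rule R.finite_extension_incl) (auto simp: carrier)
  ultimately have "finite_extension ?L"
    by (simp add: finite_extension_def)
  moreover have "S \<subseteq> ?L"
    using R.finite_extension_mem[OF subfieldE(1)[OF K], of xs] by (simp add: carrier xs)
  ultimately show ?thesis
    by (rule that)
qed

theorem theorem1:
  fixes m n :: nat and a :: "nat \<Rightarrow> 'a :: field"
  assumes "n \<ge> 1"
    and "CHAR('a) = 0 \<or> (\<exists>s n'. n' > 0 \<and> n' < CHAR('a) \<and> n = CHAR('a) ^ s * n')"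
  shows "\<exists>(L :: 'a alg_closure set) (f :: 'a alg_closure poly).
           finite_extension L \<and>
           (\<forall>i. Polynomial.coeff f i \<in> L) \<and>
           (\<forall>j\<le>m. Polynomial.coeff (f ^ n) (j * n) = to_ac (a j))"
proof -
  \<comment> \<open>The algebraic closure has the same characteristic, so the hypothesis on
    \<open>n\<close> carries over.\<close>
  obtain f :: "'a alg_closure poly" where f: "\<forall>j\<le>m. Polynomial.coeff (f ^ n) (j * n) = to_ac (a j)"
    using power_with_coeffs_exists[where b = "\<lambda>j. to_ac (a j)" and n = n and m = m] assms by auto
  \<comment> \<open>The 0 accounts for coefficients beyond the degree, which \<open>coeffs\<close>
    omits.\<close>
  have "finite (insert 0 (set (Polynomial.coeffs f)))"
    by simp
  then obtain L where L: "finite_extension L" "insert 0 (set (Polynomial.coeffs f)) \<subseteq> L"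
    by (rule finite_extension_containing_finite_set)
  then have "Polynomial.coeff f i \<in> L" for i
    using range_coeff[of f] by blast
  with L f show ?thesis
    by blast
qed

end
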